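(* Suppose that all terms of the sequence $(u_n)_{n\ge0}$ are non-negative. Then: (1) $f$ is a probability distribution function on $[0,1]$; moreover, it is the distribution function $F_\xi(x)=\mathsf{P}\{\xi<x\}$ of the random variable $\xi=\Delta^E_{\eta_1\eta_2\ldots\eta_k\ldots}$ whose $E$-symbols $\eta_k$ ($k\ge1$) are independent identically distributed random variables with $\mathsf{P}\{\eta_k=n\}=u_n$ for $n\in\mathbb{Z}_0$; (2) $f$ is strictly increasing if $u_n>0$ for every $n\in\mathbb{Z}_0$; (3) $f$ is either purely absolutely continuous or purely singular.
   Context: Let $\mathbb{Z}_0=\{0,1,2,\dots\}$. Every $x\in(0,1]$ has a unique $E$-representation, i.e. there is a unique sequence $(g_n(x))_{n\ge 1}$ of elements of $\mathbb{Z}_0$ with $x=\sum_{n=1}^\infty \frac{1}{(2+g_1)(2+g_1+g_2)\cdots(2+g_1+\dots+g_n)}$, where $g_n=g_n(x)$; this is written $x=\Delta^E_{g_1g_2\ldots g_n\ldots}$. Conversely, every sequence in $\mathbb{Z}_0$ is the $E$-representation of some $x\in(0,1]$. Standing assumptions: $(u_n)_{n\ge0}$ is a sequence of real numbers such that $\sum_{n=0}^\infty u_n$ converges with sum $1$, $|u_n|<1$ for all $n\ge 0$, and $r_n:=\sum_{i=n+1}^\infty u_i=1-(u_0+\dots+u_n)$ satisfies $0<r_n<1$ for all $n\ge0$. The function $f$ is defined on $(0,1]$ by $f(x)=r_{g_1(x)}+\sum_{k=2}^\infty\bigl(r_{g_k(x)}\prod_{i=1}^{k-1}u_{g_i(x)}\bigr)$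 (the series converges absolutely), and $f(0):=0$. A probability distribution function on $[0,1]$ is a non-decreasing continuous function with value $0$ at $0$ and $1$ at $1$ (viewed on $\mathbb{R}$ as being $0$ for $x\le 0$ and $1$ for $x\ge1$). By the Lebesgue decomposition a distribution function is a convex combination $\alpha_1F_d+\alpha_2F_{a.c.}+\alpha_3F_s$ of a discrete, an absolutely continuous and a singular (continuous with derivative $0$ Lebesgue-almost everywhere) distribution function; it is purely absolutely continuous if $\alpha_2=1$ and purely singular if $\alpha_3=1$. *)

theory Defs
  imports "HOL-Probability.Probability"
begin

(* Digit sequences are indexed from 0: the value g k is the (k+1)-st symbol of the E-representation. *)

definition E_term :: "(nat \<Rightarrow> nat) \<Rightarrow> nat \<Rightarrow> real" where
  "E_term g n = 1 / (\<Prod>j\<le>n. 2 + (\<Sum>i\<le>j. real (g i)))"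

definition E_value :: "(nat \<Rightarrow> nat) \<Rightarrow> real" where
  "E_value g = (\<Sum>n. E_term g n)"

(* Only meaningful on (0,1], where the E-representation exists and is unique. *)
definition E_digits :: "real \<Rightarrow> nat \<Rightarrow> nat" where
  "E_digits x = (THE g. E_term g sums x)"

definition tail :: "(nat \<Rightarrow> real) \<Rightarrow> nat \<Rightarrow> real" where
  "tail u n = (\<Sum>i. u (i + Suc n))"

(* Only the values on [0,1] are meaningful. *)
definition E_fun :: "(nat \<Rightarrow> real) \<Rightarrow> real \<Rightarrow> real" where
  "E_fun u x =
    (if x = 0 then 0
     else tail u (E_digits x 0)
       + (\<Sum>k. tail u (E_digits x (Suc k)) * (\<Prod>i\<le>k. u (E_digits x i))))"

definition prob_df_on_unit :: "(real \<Rightarrow> real) \<Rightarrow> bool" where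
  "prob_df_on_unit F \<longleftrightarrow>
     mono_on {0..1} F \<and> continuous_on {0..1} F \<and> F 0 = 0 \<and> F 1 = 1"

definition extend_unit :: "(real \<Rightarrow> real) \<Rightarrow> real \<Rightarrow> real" where
  "extend_unit F x = (if x < 0 then 0 else if x > 1 then 1 else F x)"

(* Distribution functions follow the convention F(x) = P(X < x), hence are left-continuous. *)
definition distribution_fun :: "(real \<Rightarrow> real) \<Rightarrow> bool" where
  "distribution_fun F \<longleftrightarrow>
     mono F \<and> (\<forall>x. continuous (at_left x) F) \<and> (F \<longlongrightarrow> 0) at_bot \<and> (F \<longlongrightarrow> 1) at_top"

(* Summability of the point masses p forces their support to be countable. *)
definition discrete_df :: "(real \<Rightarrow> real) \<Rightarrow> bool" where
  "discrete_df F \<longleftrightarrow> distribution_fun F \<and>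
     (\<exists>p. (\<forall>a. 0 \<le> p a) \<and> (p has_sum 1) UNIV \<and> (\<forall>x. (p has_sum F x) {..<x}))"

definition abs_continuous_df :: "(real \<Rightarrow> real) \<Rightarrow> bool" where
  "abs_continuous_df F \<longleftrightarrow> distribution_fun F \<and>
     (\<exists>p. (\<forall>t. 0 \<le> p t) \<and> integrable lborel p \<and>
          (\<forall>x. F x = set_lebesgue_integral lborel {..<x} p))"

definition singular_df :: "(real \<Rightarrow> real) \<Rightarrow> bool" where
  "singular_df F \<longleftrightarrow> distribution_fun F \<and> continuous_on UNIV F \<and>
     (AE x in lborel. (F has_real_derivative 0) (at x))"

(* The weights a1, a2, a3 belong to the discrete, absolutely continuous and singular components;
   a component of weight 0 is absent, so nothing is required of it. *)
definition lebesgue_weights :: "(real \<Rightarrow> real) \<Rightarrow> real \<Rightarrow> real \<Rightarrow> real \<Rightarrow> bool" where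
  "lebesgue_weights F a1 a2 a3 \<longleftrightarrow>
     0 \<le> a1 \<and> 0 \<le> a2 \<and> 0 \<le> a3 \<and> a1 + a2 + a3 = 1 \<and>
     (\<exists>Fd Fac Fs.
        (a1 > 0 \<longrightarrow> discrete_df Fd) \<and>
        (a2 > 0 \<longrightarrow> abs_continuous_df Fac) \<and>
        (a3 > 0 \<longrightarrow> singular_df Fs) \<and>
        (\<forall>x. F x = a1 * Fd x + a2 * Fac x + a3 * Fs x))"

definition purely_abs_continuous :: "(real \<Rightarrow> real) \<Rightarrow> bool" where
  "purely_abs_continuous F \<longleftrightarrow> (\<exists>a1 a3. lebesgue_weights F a1 1 a3)"

definition purely_singular :: "(real \<Rightarrow> real) \<Rightarrow> bool" where
  "purely_singular F \<longleftrightarrow> (\<exists>a1 a2. lebesgue_weights F a1 a2 1)"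

end

theory Submission
  imports Defs
begin

text \<open>The value of an \<open>E\<close>-representation is strictly decreasing in its digits for the lexicographic
  order, so \<open>\<xi> < x\<close> is the disjoint union over \<open>k\<close> of the events that \<open>\<xi>\<close> and \<open>x\<close> first differ in the
  \<open>k\<close>-th symbol and that \<open>\<xi>\<close> has the larger one; summing the probabilities gives \<open>f(x) = P(\<xi> < x)\<close>.
  As \<open>sup u\<^sub>n < 1\<close> there are no atoms, and when all \<open>u\<^sub>n\<close> are positive every cylinder has positive mass.

  The law of \<open>\<xi>\<close> is in fact always singular. Fix a symbol \<open>m\<close> with \<open>u\<^sub>m > 0\<close>; almost surely it occurs
  infinitely often in \<open>\<xi>\<close>. For a Lebesgue-random point the partial sums \<open>2 + g\<^sub>1 + \<dots> + g\<^sub>k\<close> form a Markov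
  chain that grows geometrically, so the probability of \<open>g\<^sub>k = m\<close> is summable in \<open>k\<close> and, by
  Borel-Cantelli, \<open>m\<close> occurs only finitely often Lebesgue-almost everywhere. A measure carried by a
  Lebesgue null set has a distribution function with derivative \<open>0\<close> almost everywhere, by
  Vitali's covering theorem.\<close>

section \<open>Values of \<open>E\<close>-representations\<close>

text \<open>The parameter \<open>s\<close> is the sum of the symbols already split off from the front.\<close>

definition E_term_from :: "nat \<Rightarrow> (nat \<Rightarrow> nat) \<Rightarrow> nat \<Rightarrow> real" where
  "E_term_from s g n = 1 / (\<Prod>j\<le>n. 2 + real s + (\<Sum>i\<le>j. real (g i)))"

definition E_from :: "nat \<Rightarrow> (nat \<Rightarrow> nat) \<Rightarrow> real" where
  "E_from s g = (\<Sum>n. E_term_from s g n)"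

lemma E_term_eq_from: "E_term g = E_term_from 0 g"
  by (simp add: fun_eq_iff E_term_def E_term_from_def)

lemma E_value_eq_from: "E_value g = E_from 0 g"
  by (simp add: E_value_def E_from_def E_term_eq_from)

lemma E_term_from_0: "E_term_from s g 0 = 1 / (2 + real s + real (g 0))"
  by (simp add: E_term_from_def)

lemma E_term_from_Suc:
  "E_term_from s g (Suc n) =
     E_term_from (s + g 0) (\<lambda>i. g (Suc i)) n / (2 + real s + real (g 0))"
  unfolding E_term_from_def
  by (subst prod.atMost_Suc_shift)
     (simp add: sum.atMost_Suc_shift add.assoc mult.commute del: prod.atMost_Suc sum.atMost_Suc)

lemma E_term_from_pos: "0 < E_term_from s g n"
  unfolding E_term_from_def
  by (intro divide_pos_pos prod_pos) (auto intro!: add_pos_nonneg sum_nonneg)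

lemma E_term_from_le: "E_term_from s g n \<le> (1 / (2 + real s + real (g 0))) ^ Suc n"
proof -
  let ?q = "2 + real s + real (g 0)"
  have "(\<Prod>j\<le>n. ?q) \<le> (\<Prod>j\<le>n. 2 + real s + (\<Sum>i\<le>j. real (g i)))"
  proof (rule prod_mono)
    fix j assume "j \<in> {..n}"
    have "real (g 0) \<le> (\<Sum>i\<le>j. real (g i))"
      using member_le_sum[of 0 "{..j}" "\<lambda>i. real (g i)"] by simp
    then show "0 \<le> ?q \<and> ?q \<le> 2 + real s + (\<Sum>i\<le>j. real (g i))" by simp
  qed
  then have "?q ^ Suc n \<le> (\<Prod>j\<le>n. 2 + real s + (\<Sum>i\<le>j. real (g i)))"
    by simp
  then have "1 / (\<Prod>j\<le>n. 2 + real s + (\<Sum>i\<le>j. real (g i))) \<le> 1 / ?q ^ Suc n"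
    by (intro divide_left_mono mult_pos_pos prod_pos zero_less_power)
       (auto intro!: add_pos_nonneg sum_nonneg)
  then show ?thesis by (simp add: E_term_from_def power_one_over)
qed

lemma geometric_sums_from_1:
  fixes q :: real assumes "1 < q"
  shows "(\<lambda>n. (1 / q) ^ Suc n) sums (1 / (q - 1))"
proof -
  have "(\<lambda>n. (1 / q) * (1 / q) ^ n) sums ((1 / q) * (1 / (1 - 1 / q)))"
    using assms by (intro sums_mult geometric_sums) auto
  moreover have "(1 / q) * (1 / (1 - 1 / q)) = 1 / (q - 1)"
    using assms by (simp add: field_simps)
  ultimately show ?thesis by simp
qed

lemma summable_E_term_from: "summable (E_term_from s g)"
proof (rule summable_comparison_test')
  show "summable (\<lambda>n. (1 / (2 + real s + real (g 0))) ^ Suc n)"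
    using geometric_sums_from_1[of "2 + real s + real (g 0)"] by (auto simp: sums_iff)
  show "norm (E_term_from s g n) \<le> (1 / (2 + real s + real (g 0))) ^ Suc n" for n
    using E_term_from_le[of s g n] E_term_from_pos[of s g n] by simp
qed

lemma E_from_pos: "0 < E_from s g"
  unfolding E_from_def using summable_E_term_from E_term_from_pos by (rule suminf_pos)

text \<open>The factor \<open>2 + s + g 0\<close> occurs in all denominators. Dividing it out leaves
  \<open>1\<close> and the series of the shifted sequence, with \<open>g 0\<close> moved into the
  offset.\<close>

lemma E_from_rec:
  "E_from s g = (1 + E_from (s + g 0) (\<lambda>i. g (Suc i))) / (2 + real s + real (g 0))"
proof -
  have "E_from s g = E_term_from s g 0 + (\<Sum>n. E_term_from s g (Suc n))"
    unfolding E_from_def using suminf_split_head[OF summable_E_term_from[of s g]] by simp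
  also have "(\<Sum>n. E_term_from s g (Suc n)) =
      E_from (s + g 0) (\<lambda>i. g (Suc i)) / (2 + real s + real (g 0))"
    unfolding E_from_def E_term_from_Suc by (rule suminf_divide[OF summable_E_term_from])
  finally show ?thesis by (simp add: E_term_from_0 add_divide_distrib)
qed

lemma E_from_gt: "1 / (2 + real s + real (g 0)) < E_from s g"
  unfolding E_from_rec[of s g] using E_from_pos[of "s + g 0" "\<lambda>i. g (Suc i)"]
  by (intro divide_strict_right_mono) auto

text \<open>The geometric series dominates, with equality when all later symbols are
  \<open>0\<close>. Together with \<open>E_from_gt\<close>, a first symbol \<open>n\<close> confines
  the value to \<open>(1 / (2 + s + n), 1 / (1 + s + n)]\<close>; these intervals are
  disjoint.\<close>

lemma E_from_le: "E_from s g \<le> 1 / (1 + real s + real (g 0))"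
proof -
  have "E_from s g \<le> (\<Sum>n. (1 / (2 + real s + real (g 0))) ^ Suc n)"
    unfolding E_from_def
    using geometric_sums_from_1[of "2 + real s + real (g 0)"]
    by (intro suminf_le E_term_from_le summable_E_term_from) (auto simp: sums_iff)
  also have "\<dots> = 1 / (1 + real s + real (g 0))"
    using geometric_sums_from_1[of "2 + real s + real (g 0)"] by (simp add: sums_iff)
  finally show ?thesis .
qed

lemma E_from_le_1: "E_from s g \<le> 1"
  by (rule order_trans[OF E_from_le]) simp

lemma E_value_pos: "0 < E_value g" and E_value_le_1: "E_value g \<le> 1"
  by (simp_all add: E_value_eq_from E_from_pos E_from_le_1)

lemma E_term_sums: "E_term g sums E_value g"
  unfolding E_term_eq_from E_value_eq_from E_from_def
  by (rule summable_sums[OF summable_E_term_from])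

section \<open>Lexicographic order, uniqueness and existence of digits\<close>

text \<open>If the first symbols differ, their intervals lie apart, that of the larger symbol to the
  left. A common first symbol is removed by \<open>E_from_rec\<close>, whose affine map is
  increasing.\<close>

lemma E_from_less:
  assumes "\<And>i. i < k \<Longrightarrow> g i = h i" and "g k < h k"
  shows "E_from s h < E_from s g"
  using assms
proof (induction k arbitrary: s g h)
  case 0
  have "E_from s h \<le> 1 / (1 + real s + real (h 0))" by (rule E_from_le)
  also have "\<dots> \<le> 1 / (2 + real s + real (g 0))"
    using 0 by (intro divide_left_mono) auto
  also have "\<dots> < E_from s g" by (rule E_from_gt)
  finally show ?case .
next
  case (Suc k)
  have "E_from (s + g 0) (\<lambda>i. h (Suc i)) < E_from (s + g 0) (\<lambda>i. g (Suc i))"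
    using Suc.prems by (intro Suc.IH) auto
  moreover have "h 0 = g 0" using Suc.prems by auto
  ultimately show ?case
    unfolding E_from_rec[of s g] E_from_rec[of s h] by (auto intro!: divide_strict_right_mono)
qed

lemma first_difference:
  fixes g h :: "nat \<Rightarrow> nat"
  assumes "g \<noteq> h"
  obtains k where "\<And>i. i < k \<Longrightarrow> g i = h i" "g k \<noteq> h k"
proof -
  obtain j where "g j \<noteq> h j" using assms by auto
  then show ?thesis
    using that[of "LEAST k. g k \<noteq> h k"] LeastI[of "\<lambda>k. g k \<noteq> h k" j]
      not_less_Least[of _ "\<lambda>k. g k \<noteq> h k"] by blast
qed

lemma E_value_less_iff:
  "E_value h < E_value g \<longleftrightarrow> (\<exists>k. (\<forall>i<k. h i = g i) \<and> g k < h k)"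
proof
  assume *: "E_value h < E_value g"
  then have "g \<noteq> h" by auto
  then obtain k where k: "\<And>i. i < k \<Longrightarrow> g i = h i" "g k \<noteq> h k"
    by (rule first_difference) auto
  have "g k < h k"
  proof (rule ccontr)
    assume "\<not> g k < h k"
    then have "E_value g < E_value h"
      using k unfolding E_value_eq_from by (intro E_from_less[of k]) auto
    with * show False by simp
  qed
  with k show "\<exists>k. (\<forall>i<k. h i = g i) \<and> g k < h k" by metis
next
  assume "\<exists>k. (\<forall>i<k. h i = g i) \<and> g k < h k"
  then show "E_value h < E_value g"
    unfolding E_value_eq_from using E_from_less[of _ g h 0] by metis
qed

lemma E_value_inject: "E_value g = E_value h \<longleftrightarrow> g = h"
proof
  assume *: "E_value g = E_value h"
  show "g = h"
  proof (rule ccontr)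
    assume "g \<noteq> h"
    then obtain k where k: "\<And>i. i < k \<Longrightarrow> g i = h i" "g k \<noteq> h k"
      by (rule first_difference) auto
    then have "E_value g < E_value h \<or> E_value h < E_value g"
      unfolding E_value_less_iff by (metis nat_neq_iff)
    with * show False by simp
  qed
qed simp

lemma E_digits_E_value: "E_digits (E_value g) = g"
  unfolding E_digits_def
proof (rule the_equality)
  show "E_term g sums E_value g" by (rule E_term_sums)
  fix h assume "E_term h sums E_value g"
  then have "E_value h = E_value g" by (simp add: E_value_def sums_iff)
  then show "h = g" by (simp add: E_value_inject)
qed

text \<open>Each common symbol contracts the distance by
  \<open>1 / (2 + s + g 0) \<le> 1 / 2\<close>.\<close>

lemma E_from_dist:
  assumes "\<And>i. i < k \<Longrightarrow> g i = h i"
  shows "\<bar>E_from s g - E_from s h\<bar> \<le> (1 / 2) ^ k"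
  using assms
proof (induction k arbitrary: s g h)
  case 0
  show ?case using E_from_pos[of s g] E_from_pos[of s h] E_from_le_1[of s g] E_from_le_1[of s h]
    by simp
next
  case (Suc k)
  let ?q = "2 + real s + real (g 0)"
  let ?d = "E_from (s + g 0) (\<lambda>i. g (Suc i)) - E_from (s + g 0) (\<lambda>i. h (Suc i))"
  have "h 0 = g 0" using Suc.prems by auto
  then have "E_from s g - E_from s h = ?d / ?q"
    unfolding E_from_rec[of s g] E_from_rec[of s h] by (simp add: diff_divide_distrib add_divide_distrib)
  then have "\<bar>E_from s g - E_from s h\<bar> = \<bar>?d\<bar> / ?q"
    by simp
  also have "\<dots> \<le> (1 / 2) ^ k / 2"
    using Suc.prems by (intro frac_le Suc.IH) auto
  finally show ?case by simp
qed

text \<open>The digits are read off the Engel expansion: with \<open>a\<^sub>k = \<lfloor>1 / x\<^sub>k\<rfloor>\<close>, the remainders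
  \<open>x\<^sub>k\<^sub>+\<^sub>1 = (a\<^sub>k + 1) x\<^sub>k - 1\<close> stay in \<open>(0, 1 / a\<^sub>k]\<close>, so \<open>a\<close> is non-decreasing and its
  increments are the \<open>E\<close>-symbols.\<close>

lemma E_value_surj:
  assumes "0 < x" "x \<le> 1"
  obtains g where "E_value g = x"
proof -
  define X where "X = rec_nat x (\<lambda>_ y. (real_of_int \<lfloor>1 / y\<rfloor> + 1) * y - 1)"
  define a where "a k = nat \<lfloor>1 / X k\<rfloor>" for k
  have X_0: "X 0 = x" by (simp add: X_def)
  have X_pos: "0 < X k \<and> X k \<le> 1" for k
  proof (induction k)
    case 0
    then show ?case using assms by (simp add: X_0)
  next
    case (Suc k)
    have e: "X (Suc k) = (real_of_int \<lfloor>1 / X k\<rfloor> + 1) * X k - 1" by (simp add: X_def)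
    have "1 / X k < real_of_int \<lfloor>1 / X k\<rfloor> + 1" by linarith
    then have "1 < (real_of_int \<lfloor>1 / X k\<rfloor> + 1) * X k"
      using Suc pos_divide_less_eq[of "X k" 1 "real_of_int \<lfloor>1 / X k\<rfloor> + 1"] by blast
    moreover have "real_of_int \<lfloor>1 / X k\<rfloor> \<le> 1 / X k" by linarith
    then have "real_of_int \<lfloor>1 / X k\<rfloor> * X k \<le> 1"
      using Suc pos_le_divide_eq[of "X k" "real_of_int \<lfloor>1 / X k\<rfloor>" 1] by blast
    ultimately show ?case unfolding e using Suc by (simp add: algebra_simps)
  qed
  have a_ge: "1 \<le> a k" for k
    using X_pos[of k] by (simp add: a_def le_nat_iff le_floor_iff)
  have a_le: "real (a k) * X k \<le> 1" and a_eq: "real (a k) = real_of_int \<lfloor>1 / X k\<rfloor>" for k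
  proof -
    show e: "real (a k) = real_of_int \<lfloor>1 / X k\<rfloor>"
      using a_ge[of k] unfolding a_def by linarith
    have "real_of_int \<lfloor>1 / X k\<rfloor> \<le> 1 / X k" by linarith
    then show "real (a k) * X k \<le> 1"
      unfolding e using X_pos[of k] pos_le_divide_eq[of "X k" "real_of_int \<lfloor>1 / X k\<rfloor>" 1] by blast
  qed
  have X_Suc: "X (Suc k) = (real (a k) + 1) * X k - 1" for k
    by (simp add: X_def a_eq)
  have a_mono: "a k \<le> a (Suc k)" for k
  proof -
    have "X (Suc k) \<le> X k" using a_le[of k] by (simp add: X_Suc algebra_simps)
    then have "1 / X k \<le> 1 / X (Suc k)" using X_pos by (intro divide_left_mono) auto
    then show ?thesis unfolding a_def by (intro nat_mono floor_mono)
  qed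
  \<comment> \<open>The first symbol is \<open>a 0 - 1\<close> because \<open>2\<close> plus the sum
    of the symbols up to \<open>k\<close> has to be the factor \<open>1 + a k\<close>.\<close>
  define g where "g k = (case k of 0 \<Rightarrow> a 0 - 1 | Suc j \<Rightarrow> a (Suc j) - a j)" for k
  have g_sum: "1 + (\<Sum>i\<le>k. real (g i)) = real (a k)" for k
  proof (induction k)
    case 0
    then show ?case using a_ge[of 0] by (simp add: g_def of_nat_diff)
  next
    case (Suc k)
    have "real (g (Suc k)) = real (a (Suc k)) - real (a k)"
      using a_mono[of k] by (simp add: g_def of_nat_diff)
    then show ?case using Suc by simp
  qed
  have E_term_g: "E_term g n = 1 / (\<Prod>j\<le>n. 1 + real (a j))" for n
    unfolding E_term_def by (simp flip: g_sum)
  \<comment> \<open>The exact error of the partial sums. As \<open>a j \<ge> 1\<close>, its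
    denominator is at least \<open>2 ^ n\<close>.\<close>
  have rem: "x = (\<Sum>i<n. E_term g i) + X n / (\<Prod>j<n. 1 + real (a j))" for n
  proof (induction n)
    case 0
    then show ?case by (simp add: X_0)
  next
    case (Suc n)
    have "X n = (1 + X (Suc n)) / (1 + real (a n))"
      using a_ge[of n] by (simp add: X_Suc field_simps)
    then have "X n / (\<Prod>j<n. 1 + real (a j)) =
        E_term g n + X (Suc n) / (\<Prod>j<Suc n. 1 + real (a j))"
      by (simp add: E_term_g lessThan_Suc_atMost[symmetric] add_divide_distrib mult.commute)
    with Suc show ?case by simp
  qed
  have "(\<lambda>n. x - (\<Sum>i<n. E_term g i)) \<longlonglongrightarrow> 0"
  proof (rule tendsto_sandwich)
    have "x - (\<Sum>i<n. E_term g i) = X n / (\<Prod>j<n. 1 + real (a j))" for n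
      using rem[of n] by simp
    moreover have "0 \<le> X n / (\<Prod>j<n. 1 + real (a j))" for n
      using X_pos[of n] by (intro divide_nonneg_nonneg prod_nonneg) auto
    moreover have "X n / (\<Prod>j<n. 1 + real (a j)) \<le> 1 / 2 ^ n" for n
    proof (rule frac_le)
      have "(\<Prod>j<n. 2) \<le> (\<Prod>j<n. 1 + real (a j))"
        using a_ge by (intro prod_mono) auto
      then show "2 ^ n \<le> (\<Prod>j<n. 1 + real (a j))" by simp
    qed (use X_pos[of n] in auto)
    ultimately show "\<forall>\<^sub>F n in sequentially. 0 \<le> x - (\<Sum>i<n. E_term g i)"
      and "\<forall>\<^sub>F n in sequentially. x - (\<Sum>i<n. E_term g i) \<le> 1 / 2 ^ n"
      by simp_all
    show "(\<lambda>n. 1 / 2 ^ n :: real) \<longlonglongrightarrow> 0"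
      using LIMSEQ_power_zero[of "1/2::real"] by (simp add: power_one_over)
  qed auto
  then have "(\<lambda>n. x - (x - (\<Sum>i<n. E_term g i))) \<longlonglongrightarrow> x - 0"
    by (intro tendsto_intros)
  then have "E_term g sums x" by (simp add: sums_def)
  then show ?thesis using that[of g] by (simp add: E_value_def sums_iff)
qed

section \<open>Lebesgue measure of digit sets\<close>

text \<open>A Borel set containing every \<open>E_from s g\<close> with \<open>g k = m\<close>,
  obtained by unwinding \<open>E_from_rec\<close>: the affine map takes a value with first symbol
  \<open>n\<close> to the value of the shifted sequence.\<close>

primrec digit_set :: "nat \<Rightarrow> nat \<Rightarrow> nat \<Rightarrow> real set" where
  "digit_set m 0 s = {1 / (2 + real s + real m)..1 / (1 + real s + real m)}"
| "digit_set m (Suc k) s =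
     (\<Union>n. (\<lambda>x. - 1 + (2 + real s + real n) * x) -` digit_set m k (s + n))"

lemma E_from_in_digit_set: "E_from s g \<in> digit_set (g k) k s"
proof (induction k arbitrary: s g)
  case 0
  show ?case using E_from_gt[of s g] E_from_le[of s g] by simp
next
  case (Suc k)
  have "- 1 + (2 + real s + real (g 0)) * E_from s g = E_from (s + g 0) (\<lambda>i. g (Suc i))"
    by (subst E_from_rec) (simp add: field_simps)
  then show ?case using Suc[of "s + g 0" "\<lambda>i. g (Suc i)"]
    by (auto simp del: of_nat_add intro!: exI[of _ "g 0"])
qed

lemma sets_digit_set [measurable]: "digit_set m k s \<in> sets borel"
proof (induction k arbitrary: s)
  case (Suc k)
  have "(\<lambda>x. - 1 + (2 + real s + real n) * x) -` digit_set m k (s + n) \<inter> space borel \<in> sets borel" for n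
    by (rule measurable_sets[OF _ Suc]) simp
  then show ?case by (simp add: sets.countable_UN)
qed simp

lemma emeasure_lborel_vimage_affine:
  fixes c t :: real
  assumes "0 < c" "A \<in> sets borel"
  shows "emeasure lborel ((\<lambda>x. t + c * x) -` A) = emeasure lborel A / ennreal c"
proof -
  have "emeasure lborel A = ennreal c * emeasure lborel ((\<lambda>x. t + c * x) -` A)"
    using assms
    by (subst lborel_real_affine[of c t])
       (simp_all add: emeasure_density emeasure_distr nn_integral_cmult_indicator)
  then have "emeasure lborel A = emeasure lborel ((\<lambda>x. t + c * x) -` A) * ennreal c"
    by (simp only: mult.commute)
  then show ?thesis using assms by (simp only:) (simp add: ennreal_mult_divide_eq)
qed

text \<open>The terms telescope as differences of \<open>1 / (2 * b * (b + 1))\<close> at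
  \<open>b = a + n\<close> and \<open>b = a + n + 1\<close>.\<close>

lemma sums_inverse_three_consecutive:
  fixes a :: real
  assumes "0 < a"
  shows "(\<lambda>n. 1 / ((a + real n) * (a + real n + 1) * (a + real n + 2))) sums (1 / (2 * a * (a + 1)))"
proof -
  let ?f = "\<lambda>n. 1 / (2 * (a + real n) * (a + real n + 1))"
  have "(\<lambda>n. ?f n - ?f (Suc n)) sums (?f 0 - 0)"
    by (intro telescope_sums') real_asymp
  moreover have "?f n - ?f (Suc n) = 1 / ((a + real n) * (a + real n + 1) * (a + real n + 2))" for n
  proof -
    define b where "b = a + real n"
    have "0 < b" using assms by (simp add: b_def)
    then have "1 / (2 * b * (b + 1)) - 1 / (2 * (b + 1) * (b + 1 + 1)) = 1 / (b * (b + 1) * (b + 2))"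
      by (simp add: divide_simps) (simp add: algebra_simps)
    moreover have "a + real (Suc n) = b + 1" by (simp add: b_def)
    ultimately show ?thesis unfolding b_def[symmetric] by (simp only:)
  qed
  ultimately show ?thesis by simp
qed

text \<open>The weight \<open>1 / (s + 3)\<close> makes the sum over the next digit telescope, and is what turns the
  transition of the Lebesgue measure into a contraction.\<close>

lemma emeasure_digit_set_le:
  "emeasure lborel (digit_set m k s) \<le> ennreal (2 * (3 / 4) ^ k / ((real s + 1) * (real s + 3)))"
proof (induction k arbitrary: s)
  case 0
  have "1 / (1 + real s + real m) - 1 / (2 + real s + real m)
      = 1 / ((1 + real s + real m) * (2 + real s + real m))"
    by (simp add: divide_simps)
  \<comment> \<open>The constant \<open>2\<close> of the bound arises here, from
    \<open>(s + 3) / 2 \<le> 2 + s + m\<close>.\<close>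
  also have "\<dots> \<le> 1 / ((real s + 1) * ((real s + 3) / 2))"
    by (intro divide_left_mono mult_mono) auto
  finally show ?case by (simp add: divide_simps mult.commute ennreal_leI)
next
  case (Suc k)
  let ?c = "\<lambda>n. 2 + real s + real n"
  \<comment> \<open>The scaling factor \<open>2 + s + n\<close> fits between the factors
    \<open>s + n + 1\<close> and \<open>s + n + 3\<close> of the induction hypothesis, which gives
    three consecutive factors.\<close>
  let ?t = "\<lambda>n. 1 / ((real s + 1 + real n) * (real s + 1 + real n + 1) * (real s + 1 + real n + 2))"
  have "emeasure lborel (digit_set m (Suc k) s)
      \<le> (\<Sum>n. emeasure lborel ((\<lambda>x. - 1 + ?c n * x) -` digit_set m k (s + n)))"
    unfolding digit_set.simps
  proof (rule emeasure_subadditive_countably)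
    have "(\<lambda>x. - 1 + ?c n * x) -` digit_set m k (s + n) \<inter> space borel \<in> sets borel" for n
      by (rule measurable_sets[OF _ sets_digit_set]) simp
    then show "range (\<lambda>n. (\<lambda>x. - 1 + ?c n * x) -` digit_set m k (s + n)) \<subseteq> sets lborel"
      by auto
  qed
  also have "\<dots> \<le> (\<Sum>n. ennreal (2 * (3 / 4) ^ k * ?t n))"
  proof (intro suminf_le summableI)
    fix n
    have "emeasure lborel ((\<lambda>x. - 1 + ?c n * x) -` digit_set m k (s + n))
        = emeasure lborel (digit_set m k (s + n)) / ennreal (?c n)"
      by (rule emeasure_lborel_vimage_affine) auto
    also have "\<dots> \<le> ennreal (2 * (3 / 4) ^ k / ((real (s + n) + 1) * (real (s + n) + 3))) / ennreal (?c n)"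
      by (intro divide_right_mono_ennreal Suc)
    also have "\<dots> = ennreal (2 * (3 / 4) ^ k * ?t n)"
      by (subst divide_ennreal) (auto simp: field_simps intro!: arg_cong[where f=ennreal])
    finally show "emeasure lborel ((\<lambda>x. - 1 + ?c n * x) -` digit_set m k (s + n)) \<le> ennreal (2 * (3 / 4) ^ k * ?t n)" .
  qed
  also have "\<dots> = ennreal (2 * (3 / 4) ^ k * (1 / (2 * (real s + 1) * (real s + 1 + 1))))"
    by (intro suminf_ennreal_eq sums_mult sums_inverse_three_consecutive) auto
  also have "\<dots> \<le> ennreal (2 * (3 / 4) ^ Suc k / ((real s + 1) * (real s + 3)))"
  proof (rule ennreal_leI)
    have "1 / (2 * (real s + 1) * (real s + 1 + 1)) = 1 / ((real s + 1) * (2 * real s + 4))"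
      by (simp add: algebra_simps)
    \<comment> \<open>The source of the ratio \<open>3 / 4\<close>:
      \<open>4 / 3 * (s + 3) \<le> 2 * s + 4\<close>, with equality at \<open>s = 0\<close>.\<close>
    also have "\<dots> \<le> 1 / ((real s + 1) * (4 / 3 * (real s + 3)))"
      by (intro divide_left_mono mult_left_mono) auto
    finally have "2 * (3 / 4) ^ k * (1 / (2 * (real s + 1) * (real s + 1 + 1)))
        \<le> 2 * (3 / 4) ^ k * (1 / ((real s + 1) * (4 / 3 * (real s + 3))))"
      by (intro mult_left_mono) auto
    also have "\<dots> = 2 * (3 / 4) ^ Suc k / ((real s + 1) * (real s + 3))"
    proof -
      have "2 * p * (1 / (c * (4 / 3 * d))) = 2 * (3 / 4 * p) / (c * d)" for p c d :: real
        by simp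
      then show ?thesis by (simp only: power_Suc)
    qed
    finally show "2 * (3 / 4) ^ k * (1 / (2 * (real s + 1) * (real s + 1 + 1)))
        \<le> 2 * (3 / 4) ^ Suc k / ((real s + 1) * (real s + 3))" .
  qed
  finally show ?case .
qed

text \<open>The geometric bound is summable in \<open>k\<close>, so Borel-Cantelli applies. By
  \<open>E_from_in_digit_set\<close>, this limsup contains every value in which \<open>m\<close>
  occurs infinitely often.\<close>

lemma limsup_digit_set_null: "limsup (\<lambda>k. digit_set m k s) \<in> null_sets lborel"
proof (rule borel_cantelli_limsup1)
  show "emeasure lborel (digit_set m k s) < \<infinity>" for k
    using emeasure_digit_set_le[of m k s] by (auto intro: le_less_trans)
  show "summable (\<lambda>k. measure lborel (digit_set m k s))"
  proof (rule summable_comparison_test')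
    show "summable (\<lambda>k. 2 * (3 / 4) ^ k / ((real s + 1) * (real s + 3)))"
      by (intro summable_divide summable_mult summable_geometric) auto
    show "norm (measure lborel (digit_set m k s)) \<le> 2 * (3 / 4) ^ k / ((real s + 1) * (real s + 3))" for k
      using emeasure_digit_set_le[of m k s] by (simp add: measure_def enn2real_leI)
  qed
qed simp

section \<open>Distribution functions of singular measures\<close>

text \<open>Vitali's theorem covers the points of \<open>Z\<close> where the symmetric density exceeds \<open>e\<close> by disjoint
  intervals inside an open set of small measure.\<close>

lemma negligible_upper_density:
  fixes Z :: "real set"
  assumes M: "finite_borel_measure M" and Z: "Z \<in> sets borel" "measure M Z = 0" and e: "0 < e"
  shows "negligible {x \<in> Z. \<forall>d>0. \<exists>h. 0 < h \<and> h < d \<and> e * h < measure M (cball x h)}"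
    (is "negligible ?A")
proof -
  interpret finite_borel_measure M by fact
  show ?thesis
    unfolding negligible_outer_le
  proof (intro allI impI)
    fix b :: real assume b: "0 < b"
    have "(INF U \<in> {U. Z \<subseteq> U \<and> open U}. emeasure M U) = 0"
      using outer_regular[of M Z] Z M_is_borel emeasure_finite by (simp add: emeasure_eq_measure)
    then have "(INF U \<in> {U. Z \<subseteq> U \<and> open U}. emeasure M U) < ennreal (e * b / 2)"
      using e b by simp
    then obtain U where U: "Z \<subseteq> U" "open U" "emeasure M U < ennreal (e * b / 2)"
      unfolding INF_less_iff by auto
    have mU: "measure M U < e * b / 2"
      using U(3) e b by (simp add: emeasure_eq_measure ennreal_less_iff)
    \<comment> \<open>Centres and radii of balls in \<open>U\<close> of mass above \<open>e\<close>
      times the radius. Every point of \<open>?A\<close> is the centre of arbitrarily small ones, so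
      they form a Vitali cover.\<close>
    define K where "K = {(x, h). 0 < h \<and> cball x h \<subseteq> U \<and> e * h < measure M (cball x h)}"
    obtain C where C: "countable C" "C \<subseteq> K"
      "pairwise (\<lambda>i j. disjnt (cball (fst i) (snd i)) (cball (fst j) (snd j))) C"
      "negligible (?A - (\<Union>i \<in> C. cball (fst i) (snd i)))"
    proof (rule Vitali_covering_theorem_cballs[of K snd ?A fst])
      show "0 < snd i" if "i \<in> K" for i using that by (auto simp: K_def)
      fix x d :: real assume x: "x \<in> ?A" and d: "0 < d"
      obtain r where r: "0 < r" "cball x r \<subseteq> U"
        using x U open_contains_cball[of U] by blast
      have "0 < min d r" using d r by simp
      then obtain h where h: "0 < h" "h < min d r" "e * h < measure M (cball x h)"
        using x by blast
      have "cball x h \<subseteq> cball x r" using h by auto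
      then have "(x, h) \<in> K" using h r by (auto simp: K_def)
      then show "\<exists>i. i \<in> K \<and> x \<in> cball (fst i) (snd i) \<and> snd i < d"
        using h by (intro exI[of _ "(x, h)"]) auto
    qed
    let ?B = "\<lambda>i. cball (fst i) (snd i) :: real set"
    let ?T = "\<Union>i \<in> C. ?B i"
    have disj: "disjoint_family_on ?B C"
      using C(3) by (auto simp: disjoint_family_on_def pairwise_def disjnt_def)
    have "emeasure lborel ?T = (\<integral>\<^sup>+i. emeasure lborel (?B i) \<partial>count_space C)"
      using C(1) disj by (intro emeasure_UN_countable) auto
    \<comment> \<open>A ball of radius \<open>h\<close> has length \<open>2 * h\<close>, less than
      \<open>2 / e\<close> times its mass. The balls are disjoint and lie in \<open>U\<close>, so
      their total length is at most \<open>2 / e\<close> times the mass of \<open>U\<close>; hence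
      the choice of \<open>e * b / 2\<close>.\<close>
    also have "\<dots> \<le> (\<integral>\<^sup>+i. ennreal (2 / e) * emeasure M (?B i) \<partial>count_space C)"
    proof (intro nn_integral_mono)
      fix i assume "i \<in> space (count_space C)"
      then have i: "0 < snd i" "e * snd i < measure M (?B i)" using C(2) by (auto simp: K_def)
      then have "2 * snd i \<le> 2 / e * measure M (?B i)" using e by (simp add: field_simps)
      moreover have "emeasure lborel (?B i) = ennreal (2 * snd i)"
        using i by (simp add: cball_eq_atLeastAtMost)
      ultimately show "emeasure lborel (?B i) \<le> ennreal (2 / e) * emeasure M (?B i)"
        using e by (simp add: emeasure_eq_measure ennreal_leI flip: ennreal_mult)
    qed
    also have "\<dots> = ennreal (2 / e) * (\<integral>\<^sup>+i. emeasure M (?B i) \<partial>count_space C)"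
      by (rule nn_integral_cmult) simp
    also have "(\<integral>\<^sup>+i. emeasure M (?B i) \<partial>count_space C) = emeasure M ?T"
      using C(1) disj M_is_borel by (intro emeasure_UN_countable[symmetric]) auto
    also have "ennreal (2 / e) * emeasure M ?T \<le> ennreal (2 / e) * emeasure M U"
    proof (intro mult_left_mono emeasure_mono)
      show "?T \<subseteq> U" using C(2) by (force simp: K_def)
    qed (use U M_is_borel in auto)
    also have "\<dots> \<le> ennreal b"
      using mU e b by (auto simp: emeasure_eq_measure field_simps intro!: ennreal_leI simp flip: ennreal_mult)
    finally have T: "emeasure lborel ?T \<le> ennreal b" .
    have Tb: "?T \<in> sets borel"
      using C(1) by (intro sets.countable_UN') auto
    then have Te: "emeasure lebesgue ?T = emeasure lborel ?T" by simp
    let ?N = "?A - ?T"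
    have N: "?N \<in> null_sets lebesgue" using C(4) by (simp add: negligible_iff_null_sets)
    have m: "emeasure lebesgue (?T \<union> ?N) = emeasure lborel ?T"
      using Tb N Te by (subst emeasure_Un_null_set) auto
    show "\<exists>T. ?A \<subseteq> T \<and> T \<in> lmeasurable \<and> measure lebesgue T \<le> b"
    proof (intro exI[of _ "?T \<union> ?N"] conjI)
      have "?T \<union> ?N \<in> sets lebesgue"
        using Tb null_setsD2[OF N] by (intro sets.Un) auto
      moreover have "emeasure lebesgue (?T \<union> ?N) < \<infinity>"
        unfolding m using T by (rule le_less_trans) simp
      ultimately show "?T \<union> ?N \<in> lmeasurable" by (rule fmeasurableI)
      show "measure lebesgue (?T \<union> ?N) \<le> b"
        using T m b by (simp add: measure_def enn2real_leI)
    qed auto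
  qed
qed

text \<open>Outside \<open>- Z\<close> and the countably many exceptional sets for
  \<open>e = 1 / (n + 1)\<close>, the mass of \<open>cball x h\<close> is at most
  \<open>h / (n + 1)\<close> for small \<open>h\<close>. With \<open>h = \<bar>y - x\<bar>\<close>
  it bounds the increment of \<open>cdf M\<close> between \<open>x\<close> and
  \<open>y\<close>.\<close>

lemma cdf_deriv_zero_AE:
  assumes M: "finite_borel_measure M" and Z: "Z \<in> sets borel" "measure M Z = 0"
    and null: "- Z \<in> null_sets lborel"
  shows "AE x in lborel. (cdf M has_real_derivative 0) (at x)"
proof -
  interpret finite_borel_measure M by fact
  let ?A = "\<lambda>e. {x \<in> Z. \<forall>d>0. \<exists>h. 0 < h \<and> h < d \<and> e * h < measure M (cball x h)}"
  have "?A (1 / real (Suc n)) \<in> null_sets lebesgue" for n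
    using negligible_upper_density[OF M Z, of "1 / real (Suc n)"]
    by (simp add: negligible_iff_null_sets)
  moreover have "- Z \<in> null_sets lebesgue"
    using null by (simp add: null_sets_completionI)
  ultimately have "- Z \<union> (\<Union>n. ?A (1 / real (Suc n))) \<in> null_sets lebesgue"
    by (intro null_sets.Un null_sets_UN)
  then have "AE x in lebesgue. x \<notin> - Z \<union> (\<Union>n. ?A (1 / real (Suc n)))"
    by (rule AE_not_in)
  then have "AE x in lebesgue. (cdf M has_real_derivative 0) (at x)"
  proof eventually_elim
    case (elim x)
    show ?case
      unfolding has_field_derivative_iff
    proof (rule tendstoI)
      fix e :: real assume "0 < e"
      then obtain n where n: "1 / real (Suc n) < e" using nat_approx_posE by blast
      have "x \<notin> ?A (1 / real (Suc n))" "x \<in> Z" using elim by blast+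
      then have "\<exists>d>0. \<forall>h. 0 < h \<and> h < d \<longrightarrow> \<not> 1 / real (Suc n) * h < measure M (cball x h)"
        by blast
      then obtain d where d: "0 < d"
        "\<And>h. 0 < h \<Longrightarrow> h < d \<Longrightarrow> measure M (cball x h) \<le> 1 / real (Suc n) * h"
        by (meson not_less)
      have "dist ((cdf M y - cdf M x) / (y - x)) 0 < e" if y: "y \<noteq> x" "dist y x < d" for y
      proof -
        have "\<bar>cdf M y - cdf M x\<bar> = measure M {min x y<..max x y}"
        proof (cases "x < y")
          case True
          then show ?thesis using cdf_diff_eq[of x y] cdf_nondecreasing[of x y] by simp
        next
          case False
          then show ?thesis using y cdf_diff_eq[of y x] cdf_nondecreasing[of y x] by simp
        qed
        also have "\<dots> \<le> measure M (cball x \<bar>y - x\<bar>)"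
          by (intro finite_measure_mono) (auto simp: cball_eq_atLeastAtMost M_is_borel)
        also have "\<dots> \<le> 1 / real (Suc n) * \<bar>y - x\<bar>"
          using y by (intro d) (auto simp: dist_real_def)
        also have "\<dots> < e * \<bar>y - x\<bar>"
          using n y by (intro mult_strict_right_mono) auto
        finally show ?thesis using y by (simp add: pos_divide_less_eq)
      qed
      then show "\<forall>\<^sub>F y in at x. dist ((cdf M y - cdf M x) / (y - x)) 0 < e"
        unfolding eventually_at using d(1) by blast
    qed
  qed
  then show ?thesis by (simp add: AE_completion_iff)
qed

section \<open>Independent identically distributed symbols\<close>

text \<open>The space stays arbitrary, as it is instantiated twice: by a product space for the facts
  on \<open>E_fun u\<close> alone, and by any given space with such symbols. That \<open>u\<close>
  is non-negative with sum \<open>1\<close> follows from \<open>law\<close>.\<close>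

locale iid_E_symbols = prob_space M for M :: "'a measure" +
  fixes \<eta> :: "nat \<Rightarrow> 'a \<Rightarrow> nat" and u :: "nat \<Rightarrow> real"
  assumes indep: "indep_vars (\<lambda>_. count_space UNIV) \<eta> UNIV"
    and law: "\<And>k n. prob {\<omega> \<in> space M. \<eta> k \<omega> = n} = u n"
    and u_less_1: "\<And>n. u n < 1"
begin

definition \<xi> :: "'a \<Rightarrow> real" where
  "\<xi> \<omega> = E_value (\<lambda>k. \<eta> k \<omega>)"

lemma measurable_\<eta> [measurable]: "\<eta> k \<in> measurable M (count_space UNIV)"
  using indep by (auto simp: indep_vars_def2)

lemma borel_measurable_\<xi> [measurable]: "\<xi> \<in> borel_measurable M"
proof -
  have [measurable]: "(\<lambda>\<omega>. real (\<eta> k \<omega>)) \<in> borel_measurable M" for k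
    by (rule measurable_compose[OF measurable_\<eta>]) simp
  show ?thesis unfolding \<xi>_def E_value_def E_term_def by measurable
qed

lemma \<xi>_pos: "0 < \<xi> \<omega>" and \<xi>_le_1: "\<xi> \<omega> \<le> 1"
  by (simp_all add: \<xi>_def E_value_pos E_value_le_1)

lemma u_nonneg: "0 \<le> u n"
  using law[of 0 n] by (metis measure_nonneg)

lemma prob_symbols:
  "prob {\<omega> \<in> space M. \<forall>i<k. \<eta> i \<omega> \<in> A i} = (\<Prod>i<k. prob {\<omega> \<in> space M. \<eta> i \<omega> \<in> A i})"
proof (cases "k = 0")
  case True
  then show ?thesis by (simp add: prob_space)
next
  case False
  have "prob (\<Inter>i\<in>{..<k}. \<eta> i -` A i \<inter> space M) = (\<Prod>i<k. prob (\<eta> i -` A i \<inter> space M))"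
    using False by (intro indep_varsD[OF indep]) auto
  moreover have "(\<Inter>i\<in>{..<k}. \<eta> i -` A i \<inter> space M) = {\<omega> \<in> space M. \<forall>i<k. \<eta> i \<omega> \<in> A i}"
    using False by auto
  moreover have "\<eta> i -` A i \<inter> space M = {\<omega> \<in> space M. \<eta> i \<omega> \<in> A i}" for i
    by auto
  ultimately show ?thesis by simp
qed

lemma prob_cylinder: "prob {\<omega> \<in> space M. \<forall>i<k. \<eta> i \<omega> = g i} = (\<Prod>i<k. u (g i))"
  using prob_symbols[of k "\<lambda>i. {g i}"] by (simp add: law)

text \<open>Countable additivity along an enumeration of symbols: \<open>id\<close> gives
  \<open>u sums 1\<close>, and the shift by \<open>Suc n\<close> gives
  \<open>tail u n\<close>.\<close>

lemma prob_symbol_in: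
  assumes "inj f"
  shows "(\<lambda>i. u (f i)) sums prob {\<omega> \<in> space M. \<eta> k \<omega> \<in> range f}"
proof -
  have "(\<lambda>i. prob {\<omega> \<in> space M. \<eta> k \<omega> = f i}) sums prob (\<Union>i. {\<omega> \<in> space M. \<eta> k \<omega> = f i})"
    using assms by (intro finite_measure_UNION) (auto simp: disjoint_family_on_def inj_def)
  moreover have "(\<Union>i. {\<omega> \<in> space M. \<eta> k \<omega> = f i}) = {\<omega> \<in> space M. \<eta> k \<omega> \<in> range f}"
    by auto
  ultimately show ?thesis by (simp add: law)
qed

lemma u_sums: "u sums 1"
  using prob_symbol_in[of id 0] by (simp add: prob_space)

lemma prob_symbol_greater: "prob {\<omega> \<in> space M. n < \<eta> k \<omega>} = tail u n"
proof -
  have "range (\<lambda>i. i + Suc n) = {n<..}"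
  proof safe
    fix j assume "n < j"
    then show "j \<in> range (\<lambda>i. i + Suc n)" by (intro range_eqI[of _ _ "j - Suc n"]) simp
  qed simp
  then show ?thesis
    using prob_symbol_in[of "\<lambda>i. i + Suc n" k] by (simp add: tail_def sums_iff inj_def)
qed

lemma prob_cylinder_greater:
  "prob {\<omega> \<in> space M. (\<forall>i<k. \<eta> i \<omega> = g i) \<and> g k < \<eta> k \<omega>} = tail u (g k) * (\<Prod>i<k. u (g i))"
proof -
  let ?A = "\<lambda>i. if i < k then {g i} else {g k<..}"
  have "{\<omega> \<in> space M. (\<forall>i<k. \<eta> i \<omega> = g i) \<and> g k < \<eta> k \<omega>}
      = {\<omega> \<in> space M. \<forall>i<Suc k. \<eta> i \<omega> \<in> ?A i}"
    by (auto simp: less_Suc_eq)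
  then show ?thesis
    using prob_symbols[of "Suc k" ?A] by (simp add: law prob_symbol_greater)
qed

section \<open>The distribution function of \<xi>\<close>

lemma prob_\<xi>_less_E_value:
  "(\<lambda>k. tail u (g k) * (\<Prod>i<k. u (g i))) sums prob {\<omega> \<in> space M. \<xi> \<omega> < E_value g}"
proof -
  let ?S = "\<lambda>k. {\<omega> \<in> space M. (\<forall>i<k. \<eta> i \<omega> = g i) \<and> g k < \<eta> k \<omega>}"
  have "(\<lambda>k. prob (?S k)) sums prob (\<Union>k. ?S k)"
  proof (rule finite_measure_UNION)
    show "range ?S \<subseteq> events" by (auto intro!: sets.sets_Collect_conj sets.sets_Collect_countable_All)
    \<comment> \<open>For \<open>j < k\<close>, \<open>?S k\<close> demands equality with
      \<open>g\<close> at \<open>j\<close>, where \<open>?S j\<close> demands a larger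
      symbol.\<close>
    show "disjoint_family ?S"
      unfolding disjoint_family_on_def
      by (auto simp: set_eq_iff) (metis nat_neq_iff less_irrefl)
  qed
  moreover have "(\<Union>k. ?S k) = {\<omega> \<in> space M. \<xi> \<omega> < E_value g}"
    by (auto simp: \<xi>_def E_value_less_iff)
  ultimately show ?thesis by (simp add: prob_cylinder_greater)
qed

lemma prob_\<xi>_less:
  assumes "0 < x" "x \<le> 1"
  shows "prob {\<omega> \<in> space M. \<xi> \<omega> < x} = E_fun u x"
proof -
  obtain g where g: "E_value g = x" using E_value_surj[OF assms] .
  let ?t = "\<lambda>k. tail u (g k) * (\<Prod>i<k. u (g i))"
  have "E_digits x = g" using g E_digits_E_value by auto
  then have "E_fun u x = ?t 0 + (\<Sum>k. ?t (Suc k))"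
    using assms by (simp add: E_fun_def lessThan_Suc_atMost)
  also have "\<dots> = (\<Sum>k. ?t k)"
    using prob_\<xi>_less_E_value[of g] by (subst suminf_split_head) (auto simp: sums_iff)
  finally show ?thesis
    using prob_\<xi>_less_E_value[of g] g by (simp add: sums_iff)
qed

lemma extend_unit_eq_prob: "extend_unit (E_fun u) x = prob {\<omega> \<in> space M. \<xi> \<omega> < x}"
proof -
  consider "x \<le> 0" | "0 < x" "x \<le> 1" | "1 < x" by linarith
  then show ?thesis
  proof cases
    case 1
    then have "{\<omega> \<in> space M. \<xi> \<omega> < x} = {}" using \<xi>_pos by (auto simp: not_less intro: order_trans less_imp_le)
    then have "prob {\<omega> \<in> space M. \<xi> \<omega> < x} = 0" by (simp only: measure_empty)
    moreover have "extend_unit (E_fun u) x = 0"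
      using 1 by (cases "x = 0") (simp_all add: extend_unit_def E_fun_def)
    ultimately show ?thesis by simp
  next
    case 2
    then show ?thesis by (simp add: extend_unit_def prob_\<xi>_less)
  next
    case 3
    then have "{\<omega> \<in> space M. \<xi> \<omega> < x} = space M" using \<xi>_le_1 le_less_trans by blast
    then show ?thesis using 3 by (simp add: extend_unit_def prob_space)
  qed
qed

section \<open>Absence of atoms, continuity and strict monotonicity\<close>

text \<open>As \<open>u\<close> tends to \<open>0\<close>, only finitely many terms reach
  \<open>1 / 2\<close>, and their maximum is below \<open>1\<close>.\<close>

lemma u_bounded_away_from_1:
  obtains c where "0 \<le> c" "c < 1" "\<And>n. u n \<le> c"
proof -
  have "u \<longlonglongrightarrow> 0" using u_sums by (auto simp: sums_iff intro: summable_LIMSEQ_zero)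
  then have "\<forall>\<^sub>F n in sequentially. u n < 1 / 2" by (rule order_tendstoD) simp
  then obtain N where N: "\<And>n. n \<ge> N \<Longrightarrow> u n < 1 / 2" by (auto simp: eventually_sequentially)
  let ?c = "Max (insert (1 / 2) (u ` {..<N}))"
  show ?thesis
  proof (rule that[of ?c])
    have c: "1 / 2 \<le> ?c" by (rule Max_ge) auto
    then show "0 \<le> ?c" by linarith
    show "?c < 1" using u_less_1 by simp
    show "u n \<le> ?c" for n
    proof (cases "n < N")
      case False
      then show ?thesis using N[of n] c by linarith
    qed simp
  qed
qed

text \<open>By uniqueness of digits, \<xi> hits \<open>E_value g\<close> only inside the cylinders
  of \<open>g\<close>, and the one of length \<open>k\<close> has mass at most
  \<open>c ^ k\<close>.\<close>

lemma prob_\<xi>_eq: "prob {\<omega> \<in> space M. \<xi> \<omega> = x} = 0"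
proof (cases "\<exists>g. E_value g = x")
  case True
  then obtain g where g: "E_value g = x" ..
  obtain c where c: "0 \<le> c" "c < 1" "\<And>n. u n \<le> c" using u_bounded_away_from_1 by metis
  have "prob {\<omega> \<in> space M. \<xi> \<omega> = x} \<le> c ^ k" for k
  proof -
    have "prob {\<omega> \<in> space M. \<xi> \<omega> = x} \<le> prob {\<omega> \<in> space M. \<forall>i<k. \<eta> i \<omega> = g i}"
      by (rule finite_measure_mono) (auto simp: \<xi>_def E_value_inject simp flip: g)
    also have "\<dots> \<le> (\<Prod>i<k. c)"
      unfolding prob_cylinder by (intro prod_mono) (auto simp: u_nonneg c)
    finally show ?thesis by simp
  qed
  moreover have "(\<lambda>k. c ^ k) \<longlonglongrightarrow> 0" using c by (intro LIMSEQ_power_zero) simp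
  ultimately have "prob {\<omega> \<in> space M. \<xi> \<omega> = x} \<le> 0" by (intro LIMSEQ_le_const[of _ 0]) auto
  then show ?thesis by (simp add: measure_le_0_iff)
next
  case False
  then have "{\<omega> \<in> space M. \<xi> \<omega> = x} = {}" by (auto simp: \<xi>_def)
  then show ?thesis by (simp only: measure_empty)
qed

abbreviation \<mu> :: "real measure" where
  "\<mu> \<equiv> distr M borel \<xi>"

sublocale law: real_distribution \<mu>
  by (rule real_distribution_distr) simp

lemma measure_\<mu>: "A \<in> sets borel \<Longrightarrow> measure \<mu> A = prob {\<omega> \<in> space M. \<xi> \<omega> \<in> A}"
  by (subst measure_distr) (auto intro: arg_cong[where f=prob])

text \<open>\<open>cdf\<close> uses \<open>\<le>\<close> where \<open>E_fun\<close> corresponds to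
  \<open><\<close>; they agree because \<xi> has no atoms.\<close>

lemma extend_unit_eq_cdf: "extend_unit (E_fun u) = cdf \<mu>"
proof
  fix x
  have "cdf \<mu> x = prob ({\<omega> \<in> space M. \<xi> \<omega> < x} \<union> {\<omega> \<in> space M. \<xi> \<omega> = x})"
    unfolding cdf_def by (subst measure_\<mu>) (auto intro: arg_cong[where f=prob])
  also have "\<dots> = prob {\<omega> \<in> space M. \<xi> \<omega> < x}"
    by (subst finite_measure_Union) (auto simp: prob_\<xi>_eq)
  finally show "extend_unit (E_fun u) x = cdf \<mu> x" by (simp add: extend_unit_eq_prob)
qed

lemma isCont_cdf_\<mu>: "isCont (cdf \<mu>) x"
  by (simp add: law.isCont_cdf measure_\<mu> prob_\<xi>_eq)

lemma E_fun_eq_cdf: "0 \<le> x \<Longrightarrow> x \<le> 1 \<Longrightarrow> E_fun u x = cdf \<mu> x"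
  by (simp flip: extend_unit_eq_cdf add: extend_unit_def)

lemma cdf_\<mu>_0: "cdf \<mu> 0 = 0"
  by (simp flip: extend_unit_eq_cdf add: extend_unit_def E_fun_def)

lemma cdf_\<mu>_1: "cdf \<mu> 1 = 1"
  by (simp add: cdf_def measure_\<mu> \<xi>_le_1 prob_space)

lemma prob_df_on_unit_E_fun: "prob_df_on_unit (E_fun u)"
  unfolding prob_df_on_unit_def
proof (intro conjI)
  show "mono_on {0..1} (E_fun u)"
    by (auto intro!: mono_onI simp: E_fun_eq_cdf law.cdf_nondecreasing)
  have "continuous_on {0..1} (cdf \<mu>)" by (simp add: continuous_at_imp_continuous_on isCont_cdf_\<mu>)
  then show "continuous_on {0..1} (E_fun u)"
    by (rule continuous_on_eq) (simp add: E_fun_eq_cdf)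
qed (simp_all add: E_fun_eq_cdf cdf_\<mu>_0 cdf_\<mu>_1)

text \<open>The midpoint of \<open>x\<close> and \<open>y\<close> is positive, so it has digits even
  if \<open>x = 0\<close>. A long cylinder around it has positive mass and, by
  \<open>E_from_dist\<close>, values inside \<open>{x<..y}\<close>.\<close>

lemma strict_mono_on_E_fun:
  assumes "\<And>n. 0 < u n"
  shows "strict_mono_on {0..1} (E_fun u)"
proof (rule strict_mono_onI)
  fix x y :: real assume xy: "x \<in> {0..1}" "y \<in> {0..1}" "x < y"
  define z where "z = (x + y) / 2"
  have z: "0 < z" "z \<le> 1" "x < z" "z < y" using xy by (auto simp: z_def)
  obtain g where g: "E_value g = z" using E_value_surj[OF z(1,2)] .
  obtain k where k: "(1 / 2) ^ k < min (z - x) (y - z)"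
    using real_arch_pow_inv[of "min (z - x) (y - z)" "1 / 2"] z by auto
  let ?C = "{\<omega> \<in> space M. \<forall>i<k. \<eta> i \<omega> = g i}"
  have "?C \<subseteq> {\<omega> \<in> space M. \<xi> \<omega> \<in> {x<..y}}"
  proof safe
    fix \<omega> assume "\<forall>i<k. \<eta> i \<omega> = g i"
    then have "\<bar>\<xi> \<omega> - z\<bar> \<le> (1 / 2) ^ k"
      unfolding \<xi>_def g[symmetric] E_value_eq_from by (intro E_from_dist) auto
    with k show "\<xi> \<omega> \<in> {x<..y}" by auto
  qed
  then have "prob ?C \<le> measure \<mu> {x<..y}"
    by (simp add: measure_\<mu> finite_measure_mono)
  moreover have "0 < prob ?C" unfolding prob_cylinder using assms by (intro prod_pos) auto
  ultimately have "0 < cdf \<mu> y - cdf \<mu> x" using xy by (simp add: law.cdf_diff_eq)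
  then show "E_fun u x < E_fun u y" using xy by (simp add: E_fun_eq_cdf)
qed

section \<open>Singularity of the law of \<xi>\<close>

text \<open>By independence, \<open>m\<close> is avoided at the \<open>j\<close> positions from
  \<open>K\<close> on with probability \<open>(1 - u m) ^ j\<close>, which tends to
  \<open>0\<close>; there are only countably many \<open>K\<close>.\<close>

lemma AE_symbol_infinitely_often:
  assumes "0 < u m"
  shows "AE \<omega> in M. \<exists>\<^sub>\<infinity>k. \<eta> k \<omega> = m"
proof -
  have "AE \<omega> in M. \<exists>k\<ge>K. \<eta> k \<omega> = m" for K
  proof -
    let ?N = "{\<omega> \<in> space M. \<forall>k\<ge>K. \<eta> k \<omega> \<noteq> m}"
    have "prob ?N \<le> (1 - u m) ^ j" for j
    proof -
      let ?A = "\<lambda>i. if i < K then UNIV else - {m}"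
      have "prob {\<omega> \<in> space M. \<eta> i \<omega> \<noteq> m} = 1 - u m" for i
        using prob_neg[of "\<lambda>\<omega>. \<eta> i \<omega> = m"] by (simp add: law)
      then have A: "prob {\<omega> \<in> space M. \<eta> i \<omega> \<in> ?A i} = (if i < K then 1 else 1 - u m)" for i
        by (simp add: prob_space)
      have "prob ?N \<le> prob {\<omega> \<in> space M. \<forall>i<K + j. \<eta> i \<omega> \<in> ?A i}"
        by (rule finite_measure_mono) (auto simp: not_less)
      also have "\<dots> = (\<Prod>i<K + j. if i < K then 1 else 1 - u m)"
        unfolding prob_symbols A ..
      also have "\<dots> = (1 - u m) ^ j"
        by (induction j) auto
      finally show ?thesis .
    qed
    moreover have "(\<lambda>j. (1 - u m) ^ j) \<longlonglongrightarrow> 0"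
      using assms u_less_1[of m] by (intro LIMSEQ_power_zero) simp
    ultimately have "prob ?N \<le> 0" by (intro LIMSEQ_le_const[of _ 0]) auto
    then have "prob ?N = 0" by (simp add: measure_le_0_iff)
    then have "AE \<omega> in M. \<not> (\<forall>k\<ge>K. \<eta> k \<omega> \<noteq> m)"
      by (subst (asm) prob_Collect_eq_0) auto
    then show ?thesis by simp
  qed
  then have "AE \<omega> in M. \<forall>K. \<exists>k\<ge>K. \<eta> k \<omega> = m" by (simp add: AE_all_countable)
  then show ?thesis by (simp add: INFM_nat_le)
qed

lemma singular_df_cdf_\<mu>: "singular_df (cdf \<mu>)"
  unfolding singular_df_def distribution_fun_def
proof (intro conjI allI)
  show "mono (cdf \<mu>)" by (rule monoI) (rule law.cdf_nondecreasing)
  show "continuous (at_left x) (cdf \<mu>)" for x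
    using isCont_cdf_\<mu> by (rule continuous_at_imp_continuous_at_within)
  show "continuous_on UNIV (cdf \<mu>)" by (simp add: continuous_at_imp_continuous_on isCont_cdf_\<mu>)
  show "(cdf \<mu> \<longlongrightarrow> 0) at_bot" "(cdf \<mu> \<longlongrightarrow> 1) at_top"
    by (rule law.cdf_lim_at_bot law.cdf_lim_at_top_prob)+
  obtain m where m: "0 < u m"
  proof (rule ccontr)
    assume "\<not> thesis"
    then have "u = (\<lambda>_. 0)" using that u_nonneg by (metis antisym_conv1 ext)
    then show False using u_sums by (simp add: sums_iff)
  qed
  \<comment> \<open>The Lebesgue null set that carries \<open>\<mu>\<close>; its complement plays
    the part of \<open>Z\<close> in \<open>cdf_deriv_zero_AE\<close>.\<close>
  let ?N = "limsup (\<lambda>k. digit_set m k 0)"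
  have N: "?N \<in> sets borel" using limsup_digit_set_null by auto
  have "AE \<omega> in M. \<xi> \<omega> \<in> ?N"
    using AE_symbol_infinitely_often[OF m]
  proof eventually_elim
    case (elim \<omega>)
    have "\<xi> \<omega> \<in> digit_set m k 0" if "\<eta> k \<omega> = m" for k
      using E_from_in_digit_set[of 0 "\<lambda>k. \<eta> k \<omega>" k] that by (simp add: \<xi>_def E_value_eq_from)
    then show ?case using elim
      unfolding limsup_INF_SUP INFM_nat_le by simp (metis atLeast_iff)
  qed
  then have "prob {\<omega> \<in> space M. \<xi> \<omega> \<notin> ?N} = 0"
    by (intro prob_eq_0_AE) simp
  then have "measure \<mu> (- ?N) = 0"
    using N by (subst measure_\<mu>) auto
  then show "AE x in lborel. (cdf \<mu> has_real_derivative 0) (at x)"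
    using N limsup_digit_set_null[of m 0]
    by (intro cdf_deriv_zero_AE[of \<mu> "- ?N"] law.finite_borel_measure_M) auto
qed

end

section \<open>Existence of independent symbols with weights \<open>u\<close>\<close>

text \<open>The coordinate projections on a countable power of the distribution with weights
  \<open>u\<close> serve as symbols.\<close>

lemma ex_iid_E_symbols:
  fixes u :: "nat \<Rightarrow> real"
  assumes "u sums 1" "\<And>n. 0 \<le> u n" "\<And>n. u n < 1"
  obtains M :: "(nat \<Rightarrow> nat) measure" and \<eta> where "iid_E_symbols M \<eta> u"
proof -
  have "(\<integral>\<^sup>+n. ennreal (u n) \<partial>count_space UNIV) = 1"
    using assms by (simp add: nn_integral_count_space_nat suminf_ennreal_eq[of u 1] sums_unique[symmetric])
  then have pmf: "pmf (embed_pmf u) n = u n" for n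
    using assms by (intro pmf_embed_pmf)
  let ?p = "measure_pmf (embed_pmf u)"
  let ?M = "PiM UNIV (\<lambda>_ :: nat. ?p)"
  interpret prob_space ?M by (intro prob_space_PiM measure_pmf.prob_space_axioms)
  have comp: "distr ?M (count_space UNIV) (\<lambda>\<omega>. \<omega> k) = ?p" for k
  proof -
    have "distr ?M (count_space UNIV) (\<lambda>\<omega>. \<omega> k) = distr ?M ?p (\<lambda>\<omega>. \<omega> k)"
      by (rule distr_cong) auto
    then show ?thesis by (simp add: distr_PiM_component[of UNIV "\<lambda>_. ?p"] measure_pmf.prob_space_axioms)
  qed
  have rv: "(\<lambda>\<omega>. \<omega> k) \<in> measurable ?M (count_space UNIV)" for k
    using measurable_component_singleton[of k UNIV "\<lambda>_. ?p"] by simp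
  have sets: "sets (PiM UNIV (\<lambda>_ :: nat. count_space UNIV)) = sets ?M"
    by (rule sets_PiM_cong) auto
  have "iid_E_symbols ?M (\<lambda>k \<omega>. \<omega> k) u"
  proof
    show "indep_vars (\<lambda>_. count_space UNIV) (\<lambda>k \<omega>. \<omega> k) UNIV"
    proof (subst indep_vars_iff_distr_eq_PiM)
      \<comment> \<open>Restriction to \<open>UNIV\<close> is the identity and both product
        sigma-algebras coincide, so the joint law is the product measure itself.\<close>
      have "distr ?M (PiM UNIV (\<lambda>_ :: nat. count_space UNIV)) (\<lambda>x. \<lambda>i\<in>UNIV. x i) = distr ?M ?M (\<lambda>x. x)"
        using sets by (intro distr_cong) auto
      then show "distr ?M (PiM UNIV (\<lambda>_ :: nat. count_space UNIV)) (\<lambda>x. \<lambda>i\<in>UNIV. x i)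
          = PiM UNIV (\<lambda>i. distr ?M (count_space UNIV) (\<lambda>\<omega>. \<omega> i))"
        by (simp add: comp)
    qed (use rv in auto)
    show "prob {\<omega> \<in> space ?M. \<omega> k = n} = u n" for k n
    proof -
      have "u n = measure (distr ?M (count_space UNIV) (\<lambda>\<omega>. \<omega> k)) {n}"
        by (simp add: comp measure_pmf_single pmf)
      also have "\<dots> = prob {\<omega> \<in> space ?M. \<omega> k = n}"
        using rv by (subst measure_distr) (auto intro: arg_cong[where f=prob])
      finally show ?thesis ..
    qed
  qed (rule assms)
  then show ?thesis by (rule that)
qed

theorem theorem4:
  fixes u :: "nat \<Rightarrow> real"
  assumes u_sums: "u sums 1"
    and u_abs: "\<And>n. \<bar>u n\<bar> < 1"
    and tail_bounds: "\<And>n. 0 < tail u n \<and> tail u n < 1"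
    and u_nonneg: "\<And>n. 0 \<le> u n"
  shows "(prob_df_on_unit (E_fun u) \<and>
      (\<forall>(M :: 'a measure) (\<eta> :: nat \<Rightarrow> 'a \<Rightarrow> nat).
         prob_space M \<longrightarrow>
         prob_space.indep_vars M (\<lambda>_. count_space UNIV) \<eta> UNIV \<longrightarrow>
         (\<forall>k n. measure M {\<omega> \<in> space M. \<eta> k \<omega> = n} = u n) \<longrightarrow>
           (\<lambda>\<omega>. E_value (\<lambda>k. \<eta> k \<omega>)) \<in> borel_measurable M \<and>
           (\<forall>x. extend_unit (E_fun u) x
                = measure M {\<omega> \<in> space M. E_value (\<lambda>k. \<eta> k \<omega>) < x})))
    \<and> ((\<forall>n. u n > 0) \<longrightarrow> strict_mono_on {0..1} (E_fun u))
    \<and> (purely_abs_continuous (extend_unit (E_fun u)) \<or> purely_singular (extend_unit (E_fun u)))"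
proof -
  have u_less_1: "u n < 1" for n using u_abs[of n] by simp
  obtain M0 :: "(nat \<Rightarrow> nat) measure" and \<eta>0 where iid: "iid_E_symbols M0 \<eta>0 u"
    using ex_iid_E_symbols[OF u_sums u_nonneg u_less_1] .
  interpret iid_E_symbols M0 \<eta>0 u by (rule iid)
  \<comment> \<open>The components of weight \<open>0\<close> may be any functions.\<close>
  have "lebesgue_weights (extend_unit (E_fun u)) 0 0 1"
    unfolding lebesgue_weights_def extend_unit_eq_cdf using singular_df_cdf_\<mu> by auto
  then have "purely_singular (extend_unit (E_fun u))"
    unfolding purely_singular_def by blast
  moreover have "(\<lambda>\<omega>. E_value (\<lambda>k. \<eta> k \<omega>)) \<in> borel_measurable M \<and>
      (\<forall>x. extend_unit (E_fun u) x = measure M {\<omega> \<in> space M. E_value (\<lambda>k. \<eta> k \<omega>) < x})"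
    if "prob_space M" "prob_space.indep_vars M (\<lambda>_. count_space UNIV) \<eta> UNIV"
      "\<forall>k n. measure M {\<omega> \<in> space M. \<eta> k \<omega> = n} = u n"
    for M :: "'a measure" and \<eta> :: "nat \<Rightarrow> 'a \<Rightarrow> nat"
  proof -
    \<comment> \<open>A second instance with the same \<open>u\<close>, hence with the same
      \<open>E_fun u\<close>.\<close>
    interpret X: iid_E_symbols M \<eta> u
      using that u_less_1 by (simp add: iid_E_symbols_def iid_E_symbols_axioms_def)
    show ?thesis
      using X.borel_measurable_\<xi> X.extend_unit_eq_prob by (simp add: X.\<xi>_def[abs_def])
  qed
  ultimately show ?thesis
    using prob_df_on_unit_E_fun strict_mono_on_E_fun by blast
qed

end
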